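(* Let $k\ge 3$ and let $d(n)$ be the diameter of the Schreier graph $\Gamma_n$ of the action of the Hanoi Towers group $H^{(k)}$ on the words of length $n$ over $\{0,\dots,k-1\}$. Then $$d(n)\sim e^{\,n^{\frac{1}{k-2}}}.$$
   Context: Let $X=\{0,\dots,k-1\}$ and let $X^*$ be the set of finite words over $X$, viewed as a $k$-regular rooted tree $\mathcal{T}$ (the root is the empty word, level $n$ consists of the $k^n$ words of length $n$, and the children of $u$ are the words $ux$, $x\in X$). For $0\le i<j\le k-1$ let $a_{(ij)}$ be the automorphism of $\mathcal{T}$ defined recursively by (fixing the empty word and) $$a_{(ij)}(iw)=jw,\qquad a_{(ij)}(jw)=iw,\qquad a_{(ij)}(xw)=x\,a_{(ij)}(w)\ \text{ for } x\notin\{i,j\}.$$ The Hanoi Towers group on $k$ pegs is $H^{(k)}=\langle S\rangle$ with $S=\{a_{(ij)}\mid 0\le i<j\le k-1\}$. It acts transitively on each level of $\mathcal{T}$. The Schreier graph $\Gamma_n=\Gamma_n(H^{(k)},P_n,S)$, where $P_n$ is the stabilizer of a vertex at level $n$, is the graph of the action of $H^{(k)}$ on level $n$: its vertices are the $k^n$ words of length $n$ over $X$, and each vertex $v$ is joined to $s(v)$ for each $s\in S$. These graphs are connected. The diameter is the maximal graph distance between two vertices. Asymptotic convention: $f\preceq g$ means that there exists $C>0$ such that $f(n)\le g(Cn)$ for all $n\ge1$, and $f\sim g$ means $f\preceq g$ and $g\preceq f$. (If $Cn$ is not an integer and $g$ is defined only on integers, $C$ may be taken to be a positive integer.) *)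

theory Defs
  imports
    Complex_Main
    "HOL-Algebra.Group_Action"
    "HOL-Algebra.Generated_Groups"
    "Graph_Theory.Arc_Walk"
begin

definition tree_level :: "nat \<Rightarrow> nat \<Rightarrow> nat list set" where
  "tree_level k n = {w \<in> lists {..<k}. length w = n}"

fun hanoi_move :: "nat \<Rightarrow> nat \<Rightarrow> nat list \<Rightarrow> nat list" where
  "hanoi_move i j [] = []"
| "hanoi_move i j (x # w) =
     (if x = i then j # w else if x = j then i # w else x # hanoi_move i j w)"

text \<open>
  Following the convention of \<^const>\<open>BijGroup\<close>, group elements are permutations of the
  vertex set \<open>lists {..<k}\<close> of the tree which take the value \<^const>\<open>undefined\<close> off that set.
\<close>

definition hanoi_gens :: "nat \<Rightarrow> (nat list \<Rightarrow> nat list) set" where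
  "hanoi_gens k = {restrict (hanoi_move i j) (lists {..<k}) | i j. i < j \<and> j < k}"

definition hanoi_group :: "nat \<Rightarrow> (nat list \<Rightarrow> nat list) monoid" where
  "hanoi_group k = (BijGroup (lists {..<k}))
     \<lparr>carrier := generate (BijGroup (lists {..<k})) (hanoi_gens k)\<rparr>"

definition level_action :: "nat \<Rightarrow> nat \<Rightarrow> (nat list \<Rightarrow> nat list) \<Rightarrow> nat list \<Rightarrow> nat list" where
  "level_action k n g = restrict g (tree_level k n)"

text \<open>
  The graph of an action \<open>\<phi>\<close> on \<open>E\<close> with respect to a set \<open>S\<close> of group elements: an arc
  from \<open>v\<close> to \<open>\<phi> s v\<close> for each \<open>v \<in> E\<close> and \<open>s \<in> S\<close>.
\<close>

definition schreier_graph ::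
    "'a set \<Rightarrow> ('g \<Rightarrow> 'a \<Rightarrow> 'a) \<Rightarrow> 'g set \<Rightarrow> ('a, 'a \<times> 'g) pre_digraph" where
  "schreier_graph E \<phi> S =
     \<lparr>verts = E, arcs = E \<times> S, tail = fst, head = (\<lambda>(v, s). \<phi> s v)\<rparr>"

definition hanoi_graph :: "nat \<Rightarrow> nat \<Rightarrow> (nat list, nat list \<times> (nat list \<Rightarrow> nat list)) pre_digraph"
  where "hanoi_graph k n = schreier_graph (tree_level k n) (level_action k n) (hanoi_gens k)"

text \<open>
  Distance and diameter count arcs of directed walks; for the symmetric digraphs
  \<^const>\<open>hanoi_graph\<close> (see below) these are the usual undirected notions.
  The values are meaningful for finite nonempty connected graphs only.
\<close>

definition graph_dist :: "('a, 'b) pre_digraph \<Rightarrow> 'a \<Rightarrow> 'a \<Rightarrow> nat" where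
  "graph_dist G u v = (LEAST m. \<exists>p. pre_digraph.awalk G u p v \<and> length p = m)"

definition graph_diameter :: "('a, 'b) pre_digraph \<Rightarrow> nat" where
  "graph_diameter G = Max {graph_dist G u v | u v. u \<in> verts G \<and> v \<in> verts G}"

text \<open>
  The dilation constant \<open>C\<close> is a positive integer, so that functions defined only on
  the natural numbers can be compared. For a function that extends to a nondecreasing
  one on the positive reals, allowing real \<open>C > 0\<close> gives the same relation.
\<close>

definition growth_le :: "(nat \<Rightarrow> real) \<Rightarrow> (nat \<Rightarrow> real) \<Rightarrow> bool" where
  "growth_le f g \<longleftrightarrow> (\<exists>C::nat. C > 0 \<and> (\<forall>n\<ge>1. f n \<le> g (C * n)))"

definition growth_eq :: "(nat \<Rightarrow> real) \<Rightarrow> (nat \<Rightarrow> real) \<Rightarrow> bool" where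
  "growth_eq f g \<longleftrightarrow> growth_le f g \<and> growth_le g f"

lemma hanoi_move_length: "length (hanoi_move i j w) = length w"
  by (induction w) auto

lemma hanoi_move_in_lists:
  "i < k \<Longrightarrow> j < k \<Longrightarrow> w \<in> lists {..<k} \<Longrightarrow> hanoi_move i j w \<in> lists {..<k}"
  by (induction w) auto

lemma hanoi_move_set:
  "x \<in> set (hanoi_move i j w) \<Longrightarrow> i < k \<Longrightarrow> j < k \<Longrightarrow> \<forall>x\<in>set w. x < k \<Longrightarrow> x < k"
  using hanoi_move_in_lists[of i k j w] by auto

lemma hanoi_move_involution: "hanoi_move i j (hanoi_move i j w) = w"
  by (induction w) auto

lemma hanoi_gens_apply:
  assumes "s \<in> hanoi_gens k" "w \<in> lists {..<k}"
  shows "s w \<in> lists {..<k} \<and> length (s w) = length w \<and> s (s w) = w"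
proof -
  obtain i j where "i < j" "j < k" and s: "s = restrict (hanoi_move i j) (lists {..<k})"
    using assms(1) unfolding hanoi_gens_def by blast
  then show ?thesis
    using assms(2) hanoi_move_in_lists[of i k j w]
    by (simp add: s hanoi_move_length hanoi_move_involution del: in_lists_conv_set)
qed

lemma hanoi_gens_subset: "hanoi_gens k \<subseteq> carrier (BijGroup (lists {..<k}))"
proof
  fix g assume "g \<in> hanoi_gens k"
  then obtain i j where ij: "i < j" "j < k"
    and g: "g = restrict (hanoi_move i j) (lists {..<k})"
    unfolding hanoi_gens_def by blast
  have "bij_betw (hanoi_move i j) (lists {..<k}) (lists {..<k})"
    by (rule bij_betw_byWitness[where f' = "hanoi_move i j"])
      (use ij in \<open>auto simp: hanoi_move_involution dest: hanoi_move_set[where k = k]\<close>)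
  then show "g \<in> carrier (BijGroup (lists {..<k}))"
    by (simp add: g BijGroup_def Bij_def bij_betw_restrict_eq)
qed

lemma hanoi_group_subgroup: "subgroup (carrier (hanoi_group k)) (BijGroup (lists {..<k}))"
  by (simp add: hanoi_group_def group.generate_is_subgroup group_BijGroup hanoi_gens_subset)

lemma group_hanoi_group: "group (hanoi_group k)"
  using subgroup.subgroup_is_group[OF hanoi_group_subgroup group_BijGroup]
  by (simp add: hanoi_group_def)

lemma hanoi_group_length:
  assumes "g \<in> carrier (hanoi_group k)" "w \<in> lists {..<k}"
  shows "g w \<in> lists {..<k} \<and> length (g w) = length w"
proof -
  let ?B = "BijGroup (lists {..<k})"
  have "g \<in> generate ?B (hanoi_gens k)"
    using assms(1) by (simp add: hanoi_group_def)
  then show ?thesis using assms(2)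
  proof (induction arbitrary: w)
    case one
    then show ?case by (simp add: BijGroup_def)
  next
    case (incl h)
    then show ?case
      using hanoi_gens_apply by blast
  next
    case (inv h)
    have hB: "h \<in> Bij (lists {..<k})"
      using hanoi_gens_subset inv(1) by (auto simp: BijGroup_def)
    have bij: "bij_betw h (lists {..<k}) (lists {..<k})"
      using hB by (simp add: Bij_def)
    have hw: "h w \<in> lists {..<k} \<and> length (h w) = length w" and hh: "h (h w) = w"
      using hanoi_gens_apply[OF inv] by blast+
    have "inv_into (lists {..<k}) h w = h w"
      using bij hw hh by (metis bij_betw_inv_into_left)
    then show ?case using hw hB inv(2)
      by (simp add: inv_BijGroup del: in_lists_conv_set)
  next
    case (eng h1 h2)
    have "h1 \<in> carrier ?B" "h2 \<in> carrier ?B"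
      using group.generate_in_carrier[OF group_BijGroup hanoi_gens_subset] eng.hyps by blast+
    then have "h1 \<in> Bij (lists {..<k})" "h2 \<in> Bij (lists {..<k})"
      by (simp_all add: BijGroup_def)
    then have "(h1 \<otimes>\<^bsub>?B\<^esub> h2) w = h1 (h2 w)"
      using eng.prems by (simp add: BijGroup_def compose_def del: in_lists_conv_set)
    then show ?case using eng.IH(1)[of "h2 w"] eng.IH(2)[OF eng.prems] by simp
  qed
qed

lemma level_action_Bij:
  assumes g: "g \<in> carrier (hanoi_group k)"
  shows "level_action k n g \<in> Bij (tree_level k n)"
proof -
  have gB: "bij_betw g (lists {..<k}) (lists {..<k})"
    using subgroup.mem_carrier[OF hanoi_group_subgroup g] by (simp add: BijGroup_def Bij_def)
  have "g ` tree_level k n = tree_level k n"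
  proof
    show "g ` tree_level k n \<subseteq> tree_level k n"
      using hanoi_group_length[OF g] by (auto simp: tree_level_def simp del: in_lists_conv_set)
    show "tree_level k n \<subseteq> g ` tree_level k n"
    proof
      fix w assume w: "w \<in> tree_level k n"
      then obtain v where "v \<in> lists {..<k}" "g v = w"
        using gB unfolding tree_level_def bij_betw_def
        by (metis (no_types, lifting) imageE mem_Collect_eq)
      then show "w \<in> g ` tree_level k n"
        using hanoi_group_length[OF g, of v] w
        by (auto simp: tree_level_def simp del: in_lists_conv_set)
    qed
  qed
  moreover have "inj_on g (tree_level k n)"
    using gB by (rule_tac inj_on_subset[of g "lists {..<k}"]) (auto simp: bij_betw_def tree_level_def)
  ultimately show ?thesis
    by (simp add: level_action_def Bij_def bij_betw_def)
qed

lemma level_action: "group_action (hanoi_group k) (tree_level k n) (level_action k n)"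
proof -
  have "level_action k n (g \<otimes>\<^bsub>hanoi_group k\<^esub> h) =
        level_action k n g \<otimes>\<^bsub>BijGroup (tree_level k n)\<^esub> level_action k n h"
    if g: "g \<in> carrier (hanoi_group k)" and h: "h \<in> carrier (hanoi_group k)" for g h
  proof -
    have "g \<in> Bij (lists {..<k})" "h \<in> Bij (lists {..<k})"
      using subgroup.mem_carrier[OF hanoi_group_subgroup] g h by (auto simp: BijGroup_def)
    then have "g \<otimes>\<^bsub>hanoi_group k\<^esub> h = compose (lists {..<k}) g h"
      by (simp add: hanoi_group_def BijGroup_def)
    moreover have "level_action k n g \<otimes>\<^bsub>BijGroup (tree_level k n)\<^esub> level_action k n h =
        compose (tree_level k n) (level_action k n g) (level_action k n h)"
      using level_action_Bij g h by (simp add: BijGroup_def)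
    moreover have "h w \<in> tree_level k n" if "w \<in> tree_level k n" for w
      using hanoi_group_length[OF h, of w] that
      by (auto simp: tree_level_def simp del: in_lists_conv_set)
    ultimately show ?thesis
      by (auto simp: level_action_def compose_def tree_level_def fun_eq_iff
          simp del: in_lists_conv_set)
  qed
  then show ?thesis
    using level_action_Bij
    by (auto simp: group_action_def group_hom_def group_hom_axioms_def group_hanoi_group
        group_BijGroup hom_def BijGroup_def[of "tree_level k n", THEN arg_cong[where f = carrier]])
qed

lemma level_action_hanoi_gens:
  assumes "s \<in> hanoi_gens k" "v \<in> tree_level k n"
  shows "level_action k n s v \<in> tree_level k n"
    and "level_action k n s (level_action k n s v) = v"
  using hanoi_gens_apply[of s k v] assms
  by (auto simp: level_action_def tree_level_def)

lemma pseudo_graph_hanoi_graph: "pseudo_graph (hanoi_graph k n)"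
proof -
  have "tree_level k n = {w. set w \<subseteq> {..<k} \<and> length w = n}"
    by (auto simp: tree_level_def)
  then have fin: "finite (tree_level k n)"
    by (simp add: finite_lists_length_eq)
  have "hanoi_gens k \<subseteq> (\<lambda>(i, j). restrict (hanoi_move i j) (lists {..<k})) ` ({..<k} \<times> {..<k})"
    by (force simp: hanoi_gens_def)
  then have "finite (hanoi_gens k)"
    by (rule finite_subset) simp
  with fin have "fin_digraph (hanoi_graph k n)"
    by unfold_locales
      (auto simp: hanoi_graph_def schreier_graph_def level_action_hanoi_gens)
  moreover have "symmetric (hanoi_graph k n)"
  proof -
    have "(level_action k n s v, v) \<in> arcs_ends (hanoi_graph k n)"
      if "s \<in> hanoi_gens k" "v \<in> tree_level k n" for s v
      using level_action_hanoi_gens[OF that] that(1)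
      by (force simp: arcs_ends_def arc_to_ends_def hanoi_graph_def schreier_graph_def
          intro!: image_eqI[of _ _ "(level_action k n s v, s)"])
    then show ?thesis
      by (auto simp: symmetric_def sym_def arcs_ends_def arc_to_ends_def hanoi_graph_def
          schreier_graph_def)
  qed
  ultimately show ?thesis
    by (simp add: pseudo_graph_def sym_digraph_def sym_digraph_axioms_def fin_digraph_def)
qed

end

theory Submission
  imports Defs
begin

text \<open>
  A word over the alphabet of pegs is read as a position of the Towers of Hanoi: the \<open>p\<close>-th
  letter is the peg of the \<open>p\<close>-th smallest disk. The generator \<open>a\<close> indexed by the pegs \<open>i\<close>, \<open>j\<close> moves
  the smallest disk lying on one of these pegs to the other one, which is exactly a legal move.
  Put \<open>t = k - 2\<close>. Both bounds come from a recursion that trades pegs against disks.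

  Upper bound (the Frame--Stewart strategy, started from an arbitrary position). To collect all
  disks on peg \<open>a\<close>, split the disks into small and large ones, choose two further pegs \<open>b\<close> and
  \<open>c\<close>, and collect the small disks on \<open>b\<close>; collect on \<open>a\<close> those large disks that are not on \<open>b\<close>,
  without using \<open>b\<close>; collect the small disks on \<open>c\<close>; collect on \<open>a\<close> the remaining large
  disks, without using \<open>c\<close>; and finally collect the small disks on \<open>a\<close>. These are five
  phases, three of them for the small disks with all pegs, and two for the large disks with one peg
  less. With three pegs, the classical recursion that frees the largest disk takes at most \<open>2 ^ n - 1\<close>
  moves for \<open>n\<close> disks. By Pascal's rule, \<open>5 ^ r\<close> moves suffice for \<open>r choose t\<close> disks (lemma
  \<open>reach_gather\<close>). With \<open>r\<close> a constant multiple of the \<open>t\<close>-th root of \<open>n\<close> this covers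
  \<open>n\<close> disks, and two arbitrary positions are connected through a position with all disks on one peg.

  Lower bound. Consider runs on \<open>t + 2\<close> pegs in which every disk moves at least once, from any
  initial position. Again split the disks into small and large ones, and cut the run at a time when
  half of the large disks have moved, so that half of the large disks move in either part. If in
  one part all small disks move, then induction applies to the small disks. Otherwise some small
  disk rests during that part, the large disks that move cannot use its peg, and induction applies
  to them with one peg less. Hence the two parts each take at least \<open>2 ^ r\<close> moves if the numbers of small
  and large disks are large enough for \<open>r\<close>, and so the whole run takes at least \<open>2 ^ (r + 1)\<close> moves. With
  two pegs only one disk can move at all, and the recursion shows that
  \<open>2 ^ (t + 1) * (r + 1) ^ t\<close> disks force \<open>2 ^ r\<close> moves (lemma \<open>run_length_lower_bound\<close>). It is applied
  to a walk from \<open>0\<dots>0\<close> to \<open>1\<dots>1\<close>.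
\<close>

section \<open>Moves of the Towers of Hanoi\<close>

lemma hanoi_move_commute: "hanoi_move i j w = hanoi_move j i w"
  by (induction w) auto

lemma hanoi_move_id: "i \<notin> set w \<Longrightarrow> j \<notin> set w \<Longrightarrow> hanoi_move i j w = w"
  by (induction w) auto

lemma hanoi_move_append:
  "hanoi_move i j (u @ v) =
     (if i \<in> set u \<or> j \<in> set u then hanoi_move i j u @ v else u @ hanoi_move i j v)"
  by (induction u) auto

text \<open>The rules of the game: if disk \<open>p\<close> moves, then no other disk does, and no smaller disk lies on
  the peg that \<open>p\<close> leaves or on the peg that it enters.\<close>

lemma hanoi_move_legal:
  assumes "p < length w" "hanoi_move i j w ! p \<noteq> w ! p" "q < length w" "q \<noteq> p"
  shows "hanoi_move i j w ! q = w ! q \<and> (q < p \<longrightarrow> w ! q \<noteq> w ! p \<and> w ! q \<noteq> hanoi_move i j w ! p)"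
  using assms
proof (induction w arbitrary: p q)
  case (Cons x w)
  show ?case
  proof (cases "x = i \<or> x = j")
    case True
    with Cons.prems show ?thesis
      by (auto simp: nth_Cons' split: if_splits)
  next
    case False
    have mem: "w ! p' = i \<and> hanoi_move i j w ! p' = j \<or> w ! p' = j \<and> hanoi_move i j w ! p' = i"
      if "p' < length w" "hanoi_move i j w ! p' \<noteq> w ! p'" for p'
      using that
    proof (induction w arbitrary: p')
      case (Cons y w)
      then show ?case by (cases p') (auto split: if_splits)
    qed simp
    from False Cons.prems obtain p' where p': "p = Suc p'" "p' < length w"
      "hanoi_move i j w ! p' \<noteq> w ! p'"
      by (cases p) auto
    show ?thesis
    proof (cases q)
      case 0
      with False p' mem[of p'] show ?thesis by auto
    next
      case (Suc q')
      with False Cons.prems p' Cons.IH[of p' q'] show ?thesis by auto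
    qed
  qed
qed simp

text \<open>A move between two pegs of \<open>A\<close> that changes the position. Idle applications of a generator are
  excluded because only effective moves of the small disks leave the large disks alone.\<close>

definition peg_move :: "nat set \<Rightarrow> nat list \<Rightarrow> nat list \<Rightarrow> bool" where
  "peg_move A w w' \<longleftrightarrow> (\<exists>i\<in>A. \<exists>j\<in>A. i \<noteq> j \<and> w' = hanoi_move i j w \<and> w' \<noteq> w)"

text \<open>\<open>reach A m w w'\<close>: position \<open>w'\<close> is obtained from \<open>w\<close> by at most \<open>m\<close> moves between pegs of \<open>A\<close>.\<close>

definition reach :: "nat set \<Rightarrow> nat \<Rightarrow> nat list \<Rightarrow> nat list \<Rightarrow> bool" where
  "reach A m w w' \<longleftrightarrow> (\<exists>l\<le>m. (peg_move A ^^ l) w w')"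

lemma reach_refl: "reach A m w w"
  unfolding reach_def by (intro exI[of _ 0]) auto

lemma reach_single: "peg_move A w w' \<Longrightarrow> reach A 1 w w'"
  unfolding reach_def by (intro exI[of _ 1]) auto

lemma reach_trans: "reach A l u v \<Longrightarrow> reach A m v w \<Longrightarrow> reach A (l + m) u w"
  unfolding reach_def by (meson add_mono relpowp_trans)

lemma relpowp_lift:
  assumes "\<And>x y. R x y \<Longrightarrow> S (f x) (f y)" "(R ^^ l) x y"
  shows "(S ^^ l) (f x) (f y)"
  using assms(2) by (induction l arbitrary: y) (use assms(1) in \<open>auto simp: OO_def\<close>)

lemma reach_lift:
  assumes "\<And>x y. peg_move A x y \<Longrightarrow> peg_move B (f x) (f y)" "reach A m x y" "m \<le> m'"
  shows "reach B m' (f x) (f y)"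
proof -
  obtain l where "l \<le> m" "(peg_move A ^^ l) x y"
    using assms(2) unfolding reach_def by blast
  then have "(peg_move B ^^ l) (f x) (f y)" "l \<le> m'"
    using relpowp_lift[where R = "peg_move A" and S = "peg_move B" and f = f] assms(1,3) by auto
  then show ?thesis unfolding reach_def by blast
qed

lemma reach_mono:
  assumes "reach A m x y" "A \<subseteq> B" "m \<le> m'"
  shows "reach B m' x y"
proof -
  have "peg_move B u v" if "peg_move A u v" for u v
    using that assms(2) unfolding peg_move_def by blast
  then show ?thesis
    using reach_lift[where f = "\<lambda>x. x"] assms by blast
qed

lemma peg_move_append: "peg_move A u u' \<Longrightarrow> peg_move A (u @ v) (u' @ v)"
  unfolding peg_move_def
  by (metis append_same_eq hanoi_move_append hanoi_move_id)

lemma reach_append: "reach A m u u' \<Longrightarrow> reach A m (u @ v) (u' @ v)"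
  by (rule reach_lift[where f = "\<lambda>u. u @ v"]) (auto intro: peg_move_append)

text \<open>Large disks move freely between pegs on which no small disk lies.\<close>

lemma peg_move_append_left:
  assumes "set u \<inter> A = {}" "peg_move A v v'"
  shows "peg_move A (u @ v) (u @ v')"
proof -
  obtain i j where "i \<in> A" "j \<in> A" "i \<noteq> j" "v' = hanoi_move i j v" "v' \<noteq> v"
    using assms(2) unfolding peg_move_def by blast
  moreover have "i \<notin> set u" "j \<notin> set u"
    using calculation assms(1) by auto
  ultimately show ?thesis
    unfolding peg_move_def by (intro bexI[of _ i] bexI[of _ j]) (auto simp: hanoi_move_append)
qed

lemma reach_append_left: "set u \<inter> A = {} \<Longrightarrow> reach A m v v' \<Longrightarrow> reach A m (u @ v) (u @ v')"
  by (rule reach_lift[where f = "\<lambda>v. u @ v"]) (auto intro: peg_move_append_left)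

lemma reach_sym:
  assumes "reach A m u v"
  shows "reach A m v u"
proof -
  have sym: "peg_move A x y \<Longrightarrow> peg_move A y x" for x y
    unfolding peg_move_def by (metis hanoi_move_involution)
  have "(peg_move A ^^ l) v u" if "(peg_move A ^^ l) u v" for l
    using that
  proof (induction l arbitrary: v)
    case (Suc l)
    then show ?case by (metis relpowp_Suc_E relpowp_Suc_I2 sym)
  qed simp
  then show ?thesis
    using assms unfolding reach_def by blast
qed

section \<open>Collecting disks on one peg\<close>

text \<open>The position after all disks lying on pegs of \<open>A\<close> have been collected on peg \<open>a\<close>.\<close>

definition gather :: "nat set \<Rightarrow> nat \<Rightarrow> nat list \<Rightarrow> nat list" where
  "gather A a w = map (\<lambda>x. if x \<in> A then a else x) w"

text \<open>The number of disks lying on pegs of \<open>A\<close>.\<close>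

definition disks_on :: "nat set \<Rightarrow> nat list \<Rightarrow> nat" where
  "disks_on A w = length (filter (\<lambda>x. x \<in> A) w)"

lemma gather_append [simp]: "gather A a (u @ v) = gather A a u @ gather A a v"
  by (simp add: gather_def)

lemma disks_on_append [simp]: "disks_on A (u @ v) = disks_on A u + disks_on A v"
  by (simp add: disks_on_def)

lemma gather_gather: "B \<subseteq> A \<Longrightarrow> b \<in> A \<Longrightarrow> gather A a (gather B b w) = gather A a w"
  by (auto simp: gather_def)

lemma disks_on_gather: "B \<subseteq> A \<Longrightarrow> b \<in> A \<Longrightarrow> disks_on A (gather B b w) = disks_on A w"
  by (induction w) (auto simp: disks_on_def gather_def)

lemma disks_on_mono: "B \<subseteq> A \<Longrightarrow> disks_on B w \<le> disks_on A w"
  unfolding disks_on_def by (induction w) auto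

lemma gather_id: "disks_on A w = 0 \<Longrightarrow> gather A a w = w"
  by (induction w) (auto simp: disks_on_def gather_def split: if_splits)

lemma set_gather: "set (gather A a w) \<subseteq> insert a (set w - A)"
  by (auto simp: gather_def)

lemma split_disks:
  assumes "disks_on A w \<le> x + y"
  obtains u v where "w = u @ v" "disks_on A u \<le> x" "disks_on A v \<le> y"
proof -
  have "\<exists>u v. w = u @ v \<and> disks_on A u \<le> x \<and> disks_on A v \<le> y"
    using assms
  proof (induction w arbitrary: x)
    case (Cons h w)
    show ?case
    proof (cases "h \<in> A")
      case True
      show ?thesis
      proof (cases x)
        case 0
        with Cons.prems show ?thesis
          by (intro exI[of _ "[]"] exI[of _ "h # w"]) (auto simp: disks_on_def)
      next
        case (Suc x')
        with Cons.prems True have "disks_on A w \<le> x' + y" by (simp add: disks_on_def)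
        from Cons.IH[OF this] obtain u v
          where "w = u @ v" "disks_on A u \<le> x'" "disks_on A v \<le> y" by blast
        with True Suc show ?thesis
          by (intro exI[of _ "h # u"] exI[of _ v]) (auto simp: disks_on_def)
      qed
    next
      case False
      with Cons.prems have "disks_on A w \<le> x + y" by (simp add: disks_on_def)
      from Cons.IH[OF this] obtain u v
        where "w = u @ v" "disks_on A u \<le> x" "disks_on A v \<le> y" by blast
      with False show ?thesis
        by (intro exI[of _ "h # u"] exI[of _ v]) (auto simp: disks_on_def)
    qed
  qed (auto simp: disks_on_def)
  then show ?thesis using that by blast
qed

lemma reach_gather_three_pegs:
  assumes "card A = 3" "a \<in> A"
  shows "reach A (2 ^ disks_on A w - 1) w (gather A a w)"
  using assms(2)
proof (induction "length w" arbitrary: w a)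
  case 0
  then show ?case by (simp add: gather_def reach_refl)
next
  case (Suc n)
  then obtain v x where w: "w = v @ [x]" and n: "n = length v"
    by (cases w rule: rev_cases) auto
  let ?m = "2 ^ disks_on A v - 1 :: nat"
  have small: "reach A ?m v (gather A b v)" if "b \<in> A" for b
    using Suc.hyps(1)[OF n that] .
  show ?case
  proof (cases "x \<in> A \<and> x \<noteq> a")
    case False
    then have "gather A a w = gather A a v @ [x]"
      by (auto simp: gather_def w)
    moreover have "disks_on A v \<le> disks_on A w" by (simp add: w)
    then have "?m \<le> 2 ^ disks_on A w - 1"
      by (intro diff_le_mono power_increasing) auto
    ultimately show ?thesis
      using reach_mono[OF reach_append[OF small[OF Suc.prems]] subset_refl] by (simp add: w)
  next
    case True
    have "card (A - {a, x}) = 1"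
      using assms(1) Suc.prems True by (simp add: card_Diff_subset)
    then obtain c where "c \<in> A - {a, x}"
      by (metis card.empty ex_in_conv zero_neq_one)
    then have c: "c \<in> A" "c \<noteq> a" "c \<noteq> x" by auto
    have "set (gather A c v) \<inter> {x, a} = {}"
      using set_gather[of A c v] c True Suc.prems by auto
    then have "hanoi_move x a (gather A c v @ [x]) = gather A c v @ [a]"
      by (simp add: hanoi_move_append)
    then have mid: "reach A 1 (gather A c v @ [x]) (gather A c v @ [a])"
      using True Suc.prems unfolding peg_move_def
      by (intro reach_single[unfolded peg_move_def] bexI[of _ x] bexI[of _ a]) auto
    have "reach A ?m (gather A c v) (gather A a v)"
      using Suc.hyps(1)[of "gather A c v" a] Suc.prems c n
      by (simp add: gather_gather disks_on_gather) (simp add: gather_def)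
    then have "reach A (?m + 1 + ?m) w (gather A a v @ [a])"
      unfolding w using reach_trans mid reach_append small[OF c(1)] by blast
    moreover have "?m + 1 + ?m = 2 ^ disks_on A w - 1"
      using True by (simp add: w disks_on_def)
    moreover have "gather A a w = gather A a v @ [a]"
      using True by (simp add: w gather_def)
    ultimately show ?thesis by simp
  qed
qed

lemma reach_gather:
  assumes "card A = t + 2" "t \<ge> 1" "a \<in> A" "disks_on A w \<le> r choose t"
  shows "reach A (5 ^ r) w (gather A a w)"
  using assms
proof (induction r arbitrary: A a t w)
  case 0
  then have "disks_on A w = 0" by (cases t) auto
  then show ?case by (simp add: gather_id reach_refl)
next
  case (Suc r)
  show ?case
  proof (cases "t = 1")
    case True
    have pow: "2 ^ Suc m \<le> 5 ^ m + (1::nat)" for m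
    proof (induction m)
      case (Suc m)
      have "(1::nat) \<le> 5 ^ m" by simp
      with Suc show ?case unfolding power_Suc by linarith
    qed simp
    have "(2::nat) ^ disks_on A w \<le> 2 ^ Suc r"
      using Suc.prems True by (intro power_increasing) auto
    also note pow[of r]
    finally have "2 ^ disks_on A w - 1 \<le> (5 ^ r :: nat)" by simp
    also have "\<dots> \<le> 5 ^ Suc r" by simp
    finally have "2 ^ disks_on A w - 1 \<le> (5 ^ Suc r :: nat)" .
    then show ?thesis
      using reach_gather_three_pegs[of A a w] Suc.prems True reach_mono by auto
  next
    case False
    then obtain t' where t: "t = Suc t'" "t' \<ge> 1"
      using Suc.prems(2) by (cases t) auto
    have "finite A" using Suc.prems(1) by (intro card_ge_0_finite) simp
    have "disks_on A w \<le> (r choose t) + (r choose t')"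
      using Suc.prems(4) by (simp add: t)
    then obtain u v where w: "w = u @ v" "disks_on A u \<le> r choose t" "disks_on A v \<le> r choose t'"
      by (rule split_disks)
    have "2 \<le> card (A - {a})"
      using \<open>finite A\<close> Suc.prems t by simp
    then obtain B where "B \<subseteq> A - {a}" "card B = 2"
      by (rule obtain_subset_with_card_n)
    then obtain b c where bc: "b \<in> A - {a}" "c \<in> A - {a}" "b \<noteq> c"
      by (auto simp: card_2_iff)
    let ?v1 = "gather (A - {b}) a v"
    have small: "reach A (5 ^ r) (gather A q u @ z) (gather A p u @ z)"
      if "q \<in> A" "p \<in> A" for p q z
      using reach_append[OF Suc.IH[of A t p "gather A q u"]] Suc.prems that w
      by (simp add: gather_gather disks_on_gather)
    have large: "reach A (5 ^ r) (gather A p u @ z) (gather A p u @ gather (A - {p}) a z)"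
      if "p \<in> A" "p \<noteq> a" "disks_on A z \<le> r choose t'" for p z
    proof -
      have "reach (A - {p}) (5 ^ r) z (gather (A - {p}) a z)"
        using that Suc.prems t \<open>finite A\<close> disks_on_mono[of "A - {p}" A z]
        by (intro Suc.IH[of _ t']) auto
      moreover have "set (gather A p u) \<inter> (A - {p}) = {}"
        using set_gather[of A p u] by auto
      ultimately show ?thesis
        using reach_mono[OF reach_append_left] by blast
    qed
    have 1: "reach A (5 ^ r) w (gather A b u @ v)"
      using reach_append[OF Suc.IH[of A t b u]] Suc.prems bc w by simp
    have 2: "reach A (5 ^ r) (gather A b u @ v) (gather A b u @ ?v1)"
      using large bc w by simp
    have 3: "reach A (5 ^ r) (gather A b u @ ?v1) (gather A c u @ ?v1)"
      using small bc by simp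
    have "gather (A - {c}) a ?v1 = gather A a v"
      using bc by (auto simp: gather_def)
    moreover have "disks_on A ?v1 \<le> r choose t'"
      using w Suc.prems(3) by (simp add: disks_on_gather)
    ultimately have 4: "reach A (5 ^ r) (gather A c u @ ?v1) (gather A c u @ gather A a v)"
      using large[of c ?v1] bc by simp
    have 5: "reach A (5 ^ r) (gather A c u @ gather A a v) (gather A a u @ gather A a v)"
      using small bc Suc.prems by simp
    have "5 ^ r + 5 ^ r + 5 ^ r + 5 ^ r + 5 ^ r = (5 ^ Suc r :: nat)" by simp
    then show ?thesis
      using reach_trans[OF reach_trans[OF reach_trans[OF reach_trans[OF 1 2] 3] 4] 5] w(1)
      by (metis gather_append)
  qed
qed

section \<open>Runs in which every disk moves\<close>

text \<open>\<open>legal_run D c s e\<close>: the disks in \<open>D\<close>, of which \<open>p\<close> lies on peg \<open>c \<tau> p\<close> at time \<open>\<tau>\<close>, obey the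
  rules of the game between the times \<open>s\<close> and \<open>e\<close>. Resting is allowed. Thus a run remains
  legal when some of its disks are disregarded.\<close>

definition legal_run :: "nat set \<Rightarrow> (nat \<Rightarrow> nat \<Rightarrow> nat) \<Rightarrow> nat \<Rightarrow> nat \<Rightarrow> bool" where
  "legal_run D c s e \<longleftrightarrow> (\<forall>\<tau>\<in>{s..<e}. \<forall>p\<in>D. \<forall>q\<in>D. c (Suc \<tau>) p \<noteq> c \<tau> p \<longrightarrow> q \<noteq> p \<longrightarrow>
     c (Suc \<tau>) q = c \<tau> q \<and> (q < p \<longrightarrow> c \<tau> q \<noteq> c \<tau> p \<and> c \<tau> q \<noteq> c (Suc \<tau>) p))"

text \<open>The disks in \<open>D\<close> that move between the times \<open>s\<close> and \<open>e\<close>.\<close>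

definition moved :: "nat set \<Rightarrow> (nat \<Rightarrow> nat \<Rightarrow> nat) \<Rightarrow> nat \<Rightarrow> nat \<Rightarrow> nat set" where
  "moved D c s e = {p \<in> D. \<exists>\<tau>\<in>{s..<e}. c (Suc \<tau>) p \<noteq> c \<tau> p}"

lemma legal_runD:
  assumes "legal_run D c s e" "\<tau> \<in> {s..<e}" "p \<in> D" "q \<in> D" "c (Suc \<tau>) p \<noteq> c \<tau> p" "q \<noteq> p"
  shows "c (Suc \<tau>) q = c \<tau> q" and "q < p \<Longrightarrow> c \<tau> q \<noteq> c \<tau> p \<and> c \<tau> q \<noteq> c (Suc \<tau>) p"
  using assms(1)[unfolded legal_run_def, rule_format, OF assms(2-6)] by simp_all

lemma legal_run_subset:
  assumes "legal_run D c s e" "D' \<subseteq> D" "s \<le> s'" "e' \<le> e"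
  shows "legal_run D' c s' e'"
  unfolding legal_run_def
proof (intro ballI impI)
  fix \<tau> p q assume *: "\<tau> \<in> {s'..<e'}" "p \<in> D'" "q \<in> D'" "c (Suc \<tau>) p \<noteq> c \<tau> p" "q \<noteq> p"
  then have "\<tau> \<in> {s..<e}" "p \<in> D" "q \<in> D" using assms by auto
  then show "c (Suc \<tau>) q = c \<tau> q \<and> (q < p \<longrightarrow> c \<tau> q \<noteq> c \<tau> p \<and> c \<tau> q \<noteq> c (Suc \<tau>) p)"
    using legal_runD[OF assms(1) \<open>\<tau> \<in> {s..<e}\<close> \<open>p \<in> D\<close> \<open>q \<in> D\<close> *(4,5)] by simp
qed

lemma split_small_large:
  fixes D :: "nat set"
  assumes "finite D" "m \<le> card D"
  obtains S where "S \<subseteq> D" "card S = m" "\<And>x y. x \<in> S \<Longrightarrow> y \<in> D - S \<Longrightarrow> x < y"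
proof -
  have "\<exists>S\<subseteq>D. card S = m \<and> (\<forall>x\<in>S. \<forall>y\<in>D - S. x < y)"
    using assms(2)
  proof (induction m)
    case (Suc m)
    then obtain S where S: "S \<subseteq> D" "card S = m" "\<forall>x\<in>S. \<forall>y\<in>D - S. x < y" by auto
    have fin: "finite S" using S(1) assms(1) finite_subset by blast
    then have "card (D - S) \<noteq> 0"
      using Suc.prems S by (simp add: card_Diff_subset)
    then have ne: "D - S \<noteq> {}" by force
    define x where "x = Min (D - S)"
    have x: "x \<in> D - S" "\<And>y. y \<in> D - S \<Longrightarrow> x \<le> y"
      unfolding x_def using Min_in[of "D - S"] Min_le[of "D - S"] assms(1) ne by auto
    show ?case
    proof (intro exI[of _ "insert x S"] conjI ballI)
      fix p y assume "p \<in> insert x S" "y \<in> D - insert x S"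
      then show "p < y" using x(2)[of y] S(3) by fastforce
    qed (use x S fin in auto)
  qed (intro exI[of _ "{}"], simp)
  then show ?thesis using that by blast
qed

text \<open>A large disk that moves during a period never uses the peg of a small disk that rests during
  that period.\<close>

lemma avoids_resting_disk:
  assumes "legal_run D c s e" "x \<in> D" "p \<in> D" "x < p" "x \<notin> moved D c s e" "p \<in> moved D c s e"
    "\<tau> \<in> {s..e}"
  shows "c \<tau> p \<noteq> c s x"
proof -
  have rest: "c \<tau> x = c s x" if "\<tau> \<in> {s..e}" for \<tau>
  proof -
    have "s \<le> \<tau>" "\<tau> \<le> e" using that by auto
    then show ?thesis
    proof (induction \<tau> rule: dec_induct)
      case (step \<tau>)
      then have "c (Suc \<tau>) x = c \<tau> x"
        using assms(2,5) by (auto simp: moved_def)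
      with step show ?case by simp
    qed simp
  qed
  have off: "c \<tau> p \<noteq> c s x \<and> c (Suc \<tau>) p \<noteq> c s x"
    if "\<tau> \<in> {s..<e}" "c (Suc \<tau>) p \<noteq> c \<tau> p" for \<tau>
  proof -
    have "c \<tau> x \<noteq> c \<tau> p \<and> c \<tau> x \<noteq> c (Suc \<tau>) p"
      using legal_runD(2)[OF assms(1) that(1) assms(3,2) that(2)] assms(4) by blast
    then show ?thesis using rest[of \<tau>] that by auto
  qed
  have inv: "c \<tau> p = c s x \<longleftrightarrow> c s p = c s x" if "\<tau> \<in> {s..e}" for \<tau>
  proof -
    have "s \<le> \<tau>" "\<tau> \<le> e" using that by auto
    then show ?thesis
    proof (induction \<tau> rule: dec_induct)
      case (step \<tau>)
      then have "c (Suc \<tau>) p = c s x \<longleftrightarrow> c \<tau> p = c s x"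
        using off[of \<tau>] by fastforce
      with step show ?case by simp
    qed simp
  qed
  obtain \<tau>0 where "\<tau>0 \<in> {s..<e}" "c (Suc \<tau>0) p \<noteq> c \<tau>0 p"
    using assms(6) by (auto simp: moved_def)
  with off[of \<tau>0] inv[of \<tau>0] inv[OF assms(7)] show ?thesis by auto
qed

text \<open>At most one disk moves at a time, so any given number of moved disks is attained at some time.\<close>

lemma exists_time_moved_card:
  assumes "legal_run D c s e" "finite D" "b \<le> card (moved D c s e)" "s \<le> e"
  obtains T where "s \<le> T" "T \<le> e" "card (moved D c s T) = b"
proof -
  let ?f = "\<lambda>T. int (card (moved D c s T))"
  have fin: "finite (moved D c s T)" for T
    using assms(2) by (simp add: moved_def)
  have "\<bar>?f (Suc T) - ?f T\<bar> \<le> 1" if "s \<le> T" "T < e" for T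
  proof -
    define N where "N = {p \<in> D. c (Suc T) p \<noteq> c T p}"
    have "p = q" if "p \<in> N" "q \<in> N" for p q
      using legal_runD(1)[OF assms(1), of T p q] that \<open>s \<le> T\<close> \<open>T < e\<close> by (auto simp: N_def)
    then have "card N \<le> Suc 0"
      using assms(2) by (subst card_le_Suc0_iff_eq) (auto simp: N_def)
    moreover have eq: "moved D c s (Suc T) = moved D c s T \<union> N"
      using \<open>s \<le> T\<close> by (auto simp: moved_def N_def less_Suc_eq)
    ultimately have "card (moved D c s (Suc T)) \<le> card (moved D c s T) + 1"
      using card_Un_le[of "moved D c s T" N] \<open>card N \<le> Suc 0\<close> by simp
    moreover have "card (moved D c s T) \<le> card (moved D c s (Suc T))"
      using fin[of "Suc T"] eq by (intro card_mono) auto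
    ultimately show ?thesis by linarith
  qed
  then have "\<exists>T. s \<le> T \<and> T \<le> e \<and> ?f T = int b"
    using assms(3,4) by (intro nat_intermed_int_val) (auto simp: moved_def)
  then show ?thesis using that by auto
qed

text \<open>No condition is put on the positions at the times \<open>s\<close> and \<open>e\<close>, except that the disks of \<open>D\<close> stay
  on the pegs of \<open>A\<close> throughout. This is what makes the induction work on parts of a run.\<close>

lemma run_length_lower_bound:
  assumes "finite A" "card A = t + 2" "legal_run D c s e"
    and "\<And>p \<tau>. p \<in> D \<Longrightarrow> \<tau> \<in> {s..e} \<Longrightarrow> c \<tau> p \<in> A"
    and "moved D c s e = D" "2 ^ (t + 1) * (r + 1) ^ t \<le> card D"
  shows "2 ^ r \<le> e - s"
  using assms
proof (induction r arbitrary: A t D s e)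
  case 0
  then have "moved D c s e \<noteq> {}" by auto
  then have "s < e"
    by (auto simp: moved_def)
  then show ?case by simp
next
  case (Suc r)
  have "0 < (2 ^ (t + 1) * (Suc r + 1) ^ t :: nat)"
    by (intro mult_pos_pos zero_less_power) auto
  then have "0 < card D"
    using Suc.prems(6) by linarith
  then have fin: "finite D"
    by (rule card_ge_0_finite)
  show ?case
  proof (cases "t = 0")
    case True
    \<comment> \<open>With two pegs, the larger of two disks cannot move, as this would involve a third peg.\<close>
    then have "\<not> card D \<le> Suc 0"
      using Suc.prems(6) by simp
    then obtain p q where pq: "p \<in> D" "q \<in> D" "p < q"
      using fin card_le_Suc0_iff_eq by (metis linorder_neqE_nat)
    then have "q \<in> moved D c s e"
      using Suc.prems(5) by simp
    then obtain \<tau> where \<tau>: "\<tau> \<in> {s..<e}" "c (Suc \<tau>) q \<noteq> c \<tau> q"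
      by (auto simp: moved_def)
    then have "c \<tau> p \<noteq> c \<tau> q" "c \<tau> p \<noteq> c (Suc \<tau>) q"
      using legal_runD(2)[OF Suc.prems(3) \<tau>(1) pq(2,1) \<tau>(2)] pq(3) by auto
    then have "card {c \<tau> p, c \<tau> q, c (Suc \<tau>) q} = 3"
      using \<tau>(2) by (auto simp: card_insert_if)
    moreover have "{c \<tau> p, c \<tau> q, c (Suc \<tau>) q} \<subseteq> A"
      using Suc.prems(4) pq \<tau> by auto
    ultimately have "3 \<le> card A"
      using card_mono Suc.prems(1) by metis
    then show ?thesis using Suc.prems(2) True by simp
  next
    case False
    then obtain t' where t: "t = Suc t'"
      using not0_implies_Suc by blast
    \<comment> \<open>The numbers of disks that force \<open>2 ^ r\<close> moves with all pegs, and with one peg less.\<close>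
    define a b :: nat where "a = 2 ^ (t + 1) * (r + 1) ^ t" and "b = 2 ^ (t' + 1) * (r + 1) ^ t'"
    have "a + 2 * b = 2 ^ (t + 1) * ((r + 1) ^ t' * (r + 2))"
      by (simp add: a_def b_def t algebra_simps)
    also have "\<dots> \<le> 2 ^ (t + 1) * ((r + 2) ^ t' * (r + 2))"
      by (intro mult_left_mono mult_right_mono power_mono) auto
    also have "\<dots> = 2 ^ (t + 1) * (Suc r + 1) ^ t"
      by (simp add: t)
    also have "\<dots> \<le> card D" by (rule Suc.prems(6))
    finally have cardD: "a + 2 * b \<le> card D" .
    then obtain S where S: "S \<subseteq> D" "card S = a" "\<And>x y. x \<in> S \<Longrightarrow> y \<in> D - S \<Longrightarrow> x < y"
      using split_small_large[OF fin, of a] by auto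
    define L where "L = D - S"
    have finL: "finite L" using fin by (simp add: L_def)
    have cardL: "2 * b \<le> card L"
      using cardD S(1,2) fin unfolding L_def by (simp add: card_Diff_subset finite_subset)
    \<comment> \<open>A period in which at least \<open>b\<close> large disks move takes at least \<open>2 ^ r\<close> moves.\<close>
    have period: "2 ^ r \<le> e' - s'"
      if "s \<le> s'" "e' \<le> e" "M \<subseteq> moved L c s' e'" "b \<le> card M" for s' e' M
    proof (cases "moved S c s' e' = S")
      case True
      show ?thesis
      proof (rule Suc.IH[where A = A and t = t and D = S])
        show "legal_run S c s' e'"
          using legal_run_subset[OF Suc.prems(3) S(1) that(1,2)] .
        show "c \<tau> p \<in> A" if "p \<in> S" "\<tau> \<in> {s'..e'}" for p \<tau>
          using Suc.prems(4)[of p \<tau>] that \<open>s \<le> s'\<close> \<open>e' \<le> e\<close> S(1) by auto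
      qed (use Suc.prems(1,2) True S(2) in \<open>simp_all add: a_def\<close>)
    next
      case False
      then obtain x where x: "x \<in> S" "x \<notin> moved D c s' e'"
        using S(1) by (auto simp: moved_def)
      have "0 < b" by (simp add: b_def)
      then have "M \<noteq> {}" using \<open>b \<le> card M\<close> by auto
      then have "s' < e'"
        using \<open>M \<subseteq> moved L c s' e'\<close> by (auto simp: moved_def)
      have M_sub: "M \<subseteq> L" "M \<subseteq> D" "M \<subseteq> moved D c s' e'"
        using \<open>M \<subseteq> moved L c s' e'\<close> by (auto simp: moved_def L_def)
      have xA: "c s' x \<in> A"
        using Suc.prems(4)[of x s'] x S(1) \<open>s \<le> s'\<close> \<open>e' \<le> e\<close> \<open>s' < e'\<close> by auto
      show ?thesis
      proof (rule Suc.IH[where A = "A - {c s' x}" and t = t' and D = M])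
        show "legal_run M c s' e'"
          using legal_run_subset[OF Suc.prems(3) M_sub(2) that(1,2)] .
        show "c \<tau> p \<in> A - {c s' x}" if "p \<in> M" "\<tau> \<in> {s'..e'}" for p \<tau>
        proof -
          have "x < p" using x S(3) M_sub(1) that(1) by (auto simp: L_def)
          then have "c \<tau> p \<noteq> c s' x"
            using avoids_resting_disk[of D c s' e' x p \<tau>] x S(1) M_sub that
              legal_run_subset[OF Suc.prems(3) subset_refl \<open>s \<le> s'\<close> \<open>e' \<le> e\<close>] by blast
          moreover have "c \<tau> p \<in> A"
            using Suc.prems(4)[of p \<tau>] that M_sub(2) \<open>s \<le> s'\<close> \<open>e' \<le> e\<close> by auto
          ultimately show ?thesis by simp
        qed
        show "moved M c s' e' = M"
          using M_sub(3) by (auto simp: moved_def)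
      qed (use Suc.prems(1,2) t xA \<open>b \<le> card M\<close> in \<open>simp_all add: b_def\<close>)
    qed
    have "moved L c s e = moved D c s e \<inter> L"
      by (auto simp: moved_def L_def)
    then have L_moved: "moved L c s e = L"
      using Suc.prems(5) by (auto simp: L_def)
    have "0 < b" by (simp add: b_def)
    then have "moved L c s e \<noteq> {}" using cardL L_moved by auto
    then have "s \<le> e"
      by (auto simp: moved_def)
    then obtain T where T: "s \<le> T" "T \<le> e" "card (moved L c s T) = b"
      using exists_time_moved_card[of L c s e b] L_moved cardL finL
        legal_run_subset[OF Suc.prems(3), of L s e] by (auto simp: L_def)
    have "2 ^ r \<le> T - s"
      using period[of s T "moved L c s T"] T by simp
    moreover have "2 ^ r \<le> e - T"
    proof (rule period)
      have "p \<in> moved L c T e" if "p \<in> L" "p \<notin> moved L c s T" for p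
      proof -
        have "p \<in> moved L c s e"
          using L_moved \<open>p \<in> L\<close> by simp
        then obtain \<tau> where "\<tau> \<in> {s..<e}" "c (Suc \<tau>) p \<noteq> c \<tau> p"
          by (auto simp: moved_def)
        then show ?thesis
          using that by (cases "\<tau> < T") (auto simp: moved_def)
      qed
      then show "L - moved L c s T \<subseteq> moved L c T e" by blast
      have "moved L c s T \<subseteq> L" by (auto simp: moved_def)
      then have "card (L - moved L c s T) = card L - b"
        using T(3) finL by (metis card_Diff_subset finite_subset)
      then show "b \<le> card (L - moved L c s T)"
        using cardL by linarith
    qed (use T in auto)
    ultimately show ?thesis
      using T by simp
  qed
qed

section \<open>Distances in the Schreier graphs\<close>

text \<open>One step along an arc of the graph; in contrast to \<open>peg_move\<close>, idle steps are included.\<close>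

definition hanoi_step :: "nat \<Rightarrow> nat list \<Rightarrow> nat list \<Rightarrow> bool" where
  "hanoi_step k w w' \<longleftrightarrow> (\<exists>i j. i < j \<and> j < k \<and> w' = hanoi_move i j w)"

lemma mem_tree_level_iff: "w \<in> tree_level k n \<longleftrightarrow> length w = n \<and> (\<forall>x\<in>set w. x < k)"
  by (auto simp: tree_level_def)

lemma replicate_in_tree_level: "a < k \<Longrightarrow> replicate n a \<in> tree_level k n"
  by (simp add: mem_tree_level_iff)

lemma hanoi_step_tree_level:
  assumes "hanoi_step k w w'" "w \<in> tree_level k n"
  shows "w' \<in> tree_level k n"
proof -
  obtain i j where "i < j" "j < k" "w' = hanoi_move i j w"
    using assms(1) unfolding hanoi_step_def by blast
  then show ?thesis
    using assms(2) hanoi_move_set[of _ i j w k] by (auto simp: mem_tree_level_iff hanoi_move_length)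
qed

lemma hanoi_step_iff:
  assumes "w \<in> tree_level k n"
  shows "hanoi_step k w w' \<longleftrightarrow> (\<exists>s\<in>hanoi_gens k. w' = level_action k n s w)"
  using assms unfolding hanoi_step_def hanoi_gens_def level_action_def tree_level_def
  by (fastforce simp del: in_lists_conv_set)

lemma awalk_iff_relpowp:
  assumes "u \<in> tree_level k n"
  shows "(\<exists>p. pre_digraph.awalk (hanoi_graph k n) u p v \<and> length p = m) \<longleftrightarrow> (hanoi_step k ^^ m) u v"
  using assms
proof (induction m arbitrary: u)
  case 0
  then show ?case
    by (auto simp: pre_digraph.awalk_def pre_digraph.cas.simps hanoi_graph_def schreier_graph_def)
next
  case (Suc m)
  let ?G = "hanoi_graph k n"
  have G: "verts ?G = tree_level k n" "arcs ?G = tree_level k n \<times> hanoi_gens k"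
    "tail ?G (w, s) = w" "head ?G (w, s) = level_action k n s w" for w s
    by (auto simp: hanoi_graph_def schreier_graph_def)
  have "(\<exists>p. pre_digraph.awalk ?G u p v \<and> length p = Suc m) \<longleftrightarrow>
      (\<exists>e p. pre_digraph.awalk ?G u (e # p) v \<and> length p = m)"
    by (metis length_Cons length_Suc_conv)
  also have "\<dots> \<longleftrightarrow> (\<exists>s\<in>hanoi_gens k. \<exists>p.
      pre_digraph.awalk ?G (level_action k n s u) p v \<and> length p = m)"
    using Suc.prems level_action_hanoi_gens(1)[of _ k u n]
    by (auto simp: pre_digraph.awalk_def pre_digraph.cas.simps G)
  also have "\<dots> \<longleftrightarrow> (\<exists>s\<in>hanoi_gens k. (hanoi_step k ^^ m) (level_action k n s u) v)"
    using Suc.IH level_action_hanoi_gens(1)[OF _ Suc.prems] by blast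
  also have "\<dots> \<longleftrightarrow> (\<exists>w. hanoi_step k u w \<and> (hanoi_step k ^^ m) w v)"
    by (auto simp: hanoi_step_iff[OF Suc.prems])
  also have "\<dots> \<longleftrightarrow> (hanoi_step k ^^ Suc m) u v"
    by (metis relpowp_Suc_D2 relpowp_Suc_I2)
  finally show ?case .
qed

lemma graph_dist_hanoi:
  assumes "u \<in> tree_level k n"
  shows "graph_dist (hanoi_graph k n) u v = (LEAST m. (hanoi_step k ^^ m) u v)"
  unfolding graph_dist_def awalk_iff_relpowp[OF assms] ..

lemma peg_move_imp_hanoi_step:
  assumes "peg_move {..<k} w w'"
  shows "hanoi_step k w w'"
proof -
  obtain i j where ij: "i < k" "j < k" "i \<noteq> j" "w' = hanoi_move i j w"
    using assms unfolding peg_move_def by auto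
  show ?thesis
  proof (cases "i < j")
    case True
    with ij show ?thesis unfolding hanoi_step_def by blast
  next
    case False
    with ij have "j < i" by simp
    with ij hanoi_move_commute[of i j w] show ?thesis unfolding hanoi_step_def by auto
  qed
qed

lemma hanoi_path_upper:
  assumes "k = t + 2" "t \<ge> 1" "n \<le> r choose t" "u \<in> tree_level k n" "v \<in> tree_level k n"
  obtains m where "m \<le> 2 * 5 ^ r" "(hanoi_step k ^^ m) u v"
proof -
  have "reach {..<k} (5 ^ r) w (replicate n 0)" if w: "w \<in> tree_level k n" for w
  proof -
    have "gather {..<k} 0 w = replicate n 0"
      using w by (auto simp: gather_def tree_level_def map_replicate_const[symmetric] subset_iff
          simp flip: map_replicate_const intro!: map_cong)
    moreover have "disks_on {..<k} w \<le> r choose t"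
      using w assms(3) length_filter_le[of "\<lambda>x. x \<in> {..<k}" w]
      by (auto simp: disks_on_def tree_level_def)
    ultimately show ?thesis
      using reach_gather[of "{..<k}" t 0 w r] assms(1,2) by simp
  qed
  then have "reach {..<k} (5 ^ r + 5 ^ r) u v"
    using assms(4,5) reach_trans reach_sym by blast
  then obtain m where "m \<le> 5 ^ r + 5 ^ r" "(peg_move {..<k} ^^ m) u v"
    unfolding reach_def by blast
  then have "(hanoi_step k ^^ m) u v"
    using relpowp_mono[of "peg_move {..<k}" "hanoi_step k"] peg_move_imp_hanoi_step by blast
  moreover have "m \<le> 2 * 5 ^ r"
    using \<open>m \<le> 5 ^ r + 5 ^ r\<close> by simp
  ultimately show ?thesis
    by (intro that)
qed

lemma hanoi_path_lower:
  assumes "k = t + 2" "2 ^ (t + 1) * (r + 1) ^ t \<le> n"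
    and "(hanoi_step k ^^ m) (replicate n 0) (replicate n 1)"
  shows "2 ^ r \<le> m"
proof -
  obtain f where f: "f 0 = replicate n 0" "f m = replicate n 1"
    "\<And>i. i < m \<Longrightarrow> hanoi_step k (f i) (f (Suc i))"
    using assms(3) unfolding relpowp_fun_conv by blast
  have level: "f i \<in> tree_level k n" if "i \<le> m" for i
    using that
  proof (induction i)
    case 0
    then show ?case using assms(1) by (simp add: f replicate_in_tree_level)
  next
    case (Suc i)
    then show ?case using hanoi_step_tree_level[OF f(3)[of i]] by simp
  qed
  let ?c = "\<lambda>i p. f i ! p"
  have "2 ^ r \<le> m - 0"
  proof (rule run_length_lower_bound)
    show "legal_run {..<n} ?c 0 m"
      unfolding legal_run_def
    proof (intro ballI impI)
      fix i p q
      assume i: "i \<in> {0..<m}" and pq: "p \<in> {..<n}" "q \<in> {..<n}" "f (Suc i) ! p \<noteq> f i ! p" "q \<noteq> p"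
      have "length (f i) = n" using level[of i] i by (simp add: tree_level_def)
      moreover obtain a b where "f (Suc i) = hanoi_move a b (f i)"
        using f(3)[of i] i by (auto simp: hanoi_step_def)
      ultimately show "f (Suc i) ! q = f i ! q \<and>
          (q < p \<longrightarrow> f i ! q \<noteq> f i ! p \<and> f i ! q \<noteq> f (Suc i) ! p)"
        using hanoi_move_legal[of p "f i" a b q] pq by simp
    qed
    show "f i ! p \<in> {..<k}" if "p \<in> {..<n}" "i \<in> {0..m}" for p i
      using level[of i] that by (auto simp: tree_level_def)
    show "moved {..<n} ?c 0 m = {..<n}"
    proof (intro equalityI subsetI)
      fix p assume p: "p \<in> {..<n}"
      have "\<exists>i<m. f (Suc i) ! p \<noteq> f i ! p"
      proof (rule ccontr)
        assume rest: "\<not> ?thesis"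
        have "f i ! p = f 0 ! p" if "i \<le> m" for i
          using that rest by (induction i) auto
        from this[of m] show False using f p by simp
      qed
      then show "p \<in> moved {..<n} ?c 0 m"
        using p by (auto simp: moved_def)
    qed (auto simp: moved_def)
  qed (use assms(1,2) in auto)
  then show ?thesis by simp
qed

lemma finite_tree_level: "finite (tree_level k n)"
proof -
  have "tree_level k n = {w. set w \<subseteq> {..<k} \<and> length w = n}"
    by (auto simp: tree_level_def)
  then show ?thesis by (simp add: finite_lists_length_eq)
qed

lemma graph_diameter_hanoi:
  "graph_diameter (hanoi_graph k n) =
    Max ((\<lambda>(u, v). LEAST m. (hanoi_step k ^^ m) u v) ` (tree_level k n \<times> tree_level k n))"
proof -
  have "verts (hanoi_graph k n) = tree_level k n"
    by (simp add: hanoi_graph_def schreier_graph_def)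
  then have "{graph_dist (hanoi_graph k n) u v | u v.
        u \<in> verts (hanoi_graph k n) \<and> v \<in> verts (hanoi_graph k n)} =
      (\<lambda>(u, v). graph_dist (hanoi_graph k n) u v) ` (tree_level k n \<times> tree_level k n)"
    by auto
  also have "\<dots> = (\<lambda>(u, v). LEAST m. (hanoi_step k ^^ m) u v) ` (tree_level k n \<times> tree_level k n)"
    by (intro image_cong) (auto simp: graph_dist_hanoi)
  finally show ?thesis by (simp add: graph_diameter_def)
qed

lemma graph_diameter_hanoi_upper:
  assumes "k = t + 2" "t \<ge> 1" "n \<le> r choose t"
  shows "graph_diameter (hanoi_graph k n) \<le> 2 * 5 ^ r"
proof -
  have "(LEAST m. (hanoi_step k ^^ m) u v) \<le> 2 * 5 ^ r"
    if "u \<in> tree_level k n" "v \<in> tree_level k n" for u v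
    using hanoi_path_upper[OF assms that] Least_le le_trans by metis
  moreover have "replicate n 0 \<in> tree_level k n"
    using assms(1) by (simp add: replicate_in_tree_level)
  ultimately show ?thesis
    unfolding graph_diameter_hanoi using finite_tree_level by (intro Max.boundedI) auto
qed

lemma power_le_binomial:
  fixes t q :: nat
  assumes "t \<ge> 1" "q \<ge> 1"
  shows "q ^ t \<le> t * q choose t"
proof -
  have "t \<le> t * q" using assms(2) by simp
  then have "(real (t * q) / real t) ^ t \<le> real (t * q choose t)"
    by (rule binomial_ge_n_over_k_pow_k)
  then have "real (q ^ t) \<le> real (t * q choose t)" using assms(1) by simp
  then show ?thesis by (simp only: of_nat_le_iff)
qed

lemma graph_diameter_hanoi_lower:
  assumes "k = t + 2" "t \<ge> 1" "2 ^ (t + 1) * (r + 1) ^ t \<le> n"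
  shows "2 ^ r \<le> graph_diameter (hanoi_graph k n)"
proof -
  let ?u = "replicate n (0::nat)" and ?v = "replicate n (1::nat)"
  have uv: "?u \<in> tree_level k n" "?v \<in> tree_level k n"
    using assms(1) by (simp_all add: replicate_in_tree_level)
  \<comment> \<open>The least length is attained because the two vertices are connected.\<close>
  have "(n + 1) ^ t \<le> t * (n + 1) choose t"
    using power_le_binomial[of t "n + 1"] assms(2) by simp
  moreover have "n + 1 \<le> (n + 1) ^ t"
    using assms(2) by (intro self_le_power) auto
  ultimately have "n \<le> t * (n + 1) choose t" by linarith
  from hanoi_path_upper[OF assms(1,2) this uv]
  have "(hanoi_step k ^^ (LEAST m. (hanoi_step k ^^ m) ?u ?v)) ?u ?v"
    by (metis LeastI)
  then have "2 ^ r \<le> (LEAST m. (hanoi_step k ^^ m) ?u ?v)"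
    using hanoi_path_lower[OF assms(1,3)] by blast
  also have "\<dots> \<le> graph_diameter (hanoi_graph k n)"
    unfolding graph_diameter_hanoi using finite_tree_level uv
    by (intro Max_ge) (auto intro!: image_eqI[of _ _ "(?u, ?v)"])
  finally show ?thesis .
qed

section \<open>The growth of the diameter\<close>

text \<open>An integer that approximates the \<open>t\<close>-th root of \<open>n\<close> up to a factor of two.\<close>

lemma integer_root:
  fixes n t :: nat
  assumes "n \<ge> 1" "t \<ge> 1"
  obtains q :: nat where "real n powr (1 / real t) \<le> real q" "real q \<le> 2 * real n powr (1 / real t)"
    "n \<le> q ^ t" "q ^ t \<le> 2 ^ t * n"
proof -
  define x where "x = real n powr (1 / real t)"
  have x1: "1 \<le> x" using assms by (simp add: x_def ge_one_powr_ge_zero)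
  have xt: "x ^ t = real n"
    using assms by (simp add: x_def powr_powr flip: powr_realpow)
  define q where "q = nat \<lceil>x\<rceil>"
  have q: "x \<le> real q" "real q \<le> 2 * x"
    using x1 unfolding q_def by linarith+
  have "x ^ t \<le> real q ^ t" using q(1) x1 by (intro power_mono) auto
  then have "real n \<le> real (q ^ t)" by (simp add: xt)
  moreover have "real q ^ t \<le> (2 * x) ^ t" using q(2) by (intro power_mono) auto
  then have "real (q ^ t) \<le> real (2 ^ t * n)" by (simp add: power_mult_distrib xt)
  ultimately show ?thesis
    using that q by (simp only: of_nat_le_iff x_def)
qed

lemma powr_dilation:
  fixes n t c :: nat
  assumes "t \<ge> 1"
  shows "real (c ^ t * n) powr (1 / real t) = real c * real n powr (1 / real t)"
proof -
  have "real (c ^ t) powr (1 / real t) = real c"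
  proof (cases "c = 0")
    case False
    then have "real (c ^ t) = real c powr real t" by (simp add: powr_realpow)
    then show ?thesis using assms False by (simp add: powr_powr)
  qed (use assms in \<open>simp add: power_0_left\<close>)
  then show ?thesis by (simp add: powr_mult)
qed

theorem theorem2p2:
  fixes k :: nat
  assumes "k \<ge> 3"
  shows "growth_eq (\<lambda>n. real (graph_diameter (hanoi_graph k n)))
           (\<lambda>n. exp (real n powr (1 / (real k - 2))))"
proof -
  define t where "t = k - 2"
  have t: "k = t + 2" "t \<ge> 1" "real k - 2 = real t"
    using assms by (auto simp: t_def)
  have upper: "real (graph_diameter (hanoi_graph k n)) \<le> exp (real ((1 + 4 * t) ^ t * n) powr (1 / real t))"
    if n: "n \<ge> 1" for n
  proof -
    define x where "x = real n powr (1 / real t)"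
    have x1: "1 \<le> x" using n t by (simp add: x_def ge_one_powr_ge_zero)
    obtain q where q: "x \<le> real q" "real q \<le> 2 * x" "n \<le> q ^ t"
      using integer_root[OF n t(2)] unfolding x_def by metis
    \<comment> \<open>The collecting strategy is applied with \<open>r = t * q\<close>.\<close>
    have "1 \<le> q" using x1 q(1) by linarith
    then have "n \<le> t * q choose t"
      using q(3) power_le_binomial[of t q] t(2) by simp
    then have "graph_diameter (hanoi_graph k n) \<le> 2 * 5 ^ (t * q)"
      by (rule graph_diameter_hanoi_upper[OF t(1,2)])
    then have "real (graph_diameter (hanoi_graph k n)) \<le> 2 * 5 ^ (t * q)"
      by (metis of_nat_le_iff of_nat_mult of_nat_numeral of_nat_power)
    also have "\<dots> \<le> exp 1 * exp 2 ^ (t * q)"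
    proof -
      have e: "(2::real) \<le> exp 1" using exp_ge_add_one_self[of 1] by simp
      have "(5::real) \<le> exp 2" using exp_lower_Taylor_quadratic[of 2] by simp
      with e show ?thesis by (intro mult_mono power_mono) auto
    qed
    also have "\<dots> = exp (1 + 2 * real t * real q)"
      by (simp add: exp_add exp_of_nat_mult[symmetric] mult_ac)
    also have "\<dots> \<le> exp (real (1 + 4 * t) * x)"
    proof -
      have "2 * real t * real q \<le> 2 * real t * (2 * x)"
        using q(2) by (intro mult_left_mono) auto
      then show ?thesis using x1 by (simp add: algebra_simps)
    qed
    finally show ?thesis using powr_dilation[OF t(2), of "1 + 4 * t" n] by (simp add: x_def)
  qed
  have lower: "exp (real n powr (1 / real t)) \<le> real (graph_diameter (hanoi_graph k (2 * 12 ^ t * n)))"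
    if n: "n \<ge> 1" for n
  proof -
    obtain q where q: "real n powr (1 / real t) \<le> real q" "n \<le> q ^ t" "q ^ t \<le> 2 ^ t * n"
      using integer_root[OF n t(2)] by metis
    \<comment> \<open>The lower bound is applied with \<open>r = 2 * q\<close>, as \<open>4 ^ q\<close> exceeds \<open>exp q\<close>.\<close>
    have "1 \<le> q" using n q(2) t(2) by (cases q) (auto simp: power_0_left)
    then have "(2 * q + 1) ^ t \<le> (3 * q) ^ t" by (intro power_mono) auto
    also have "\<dots> \<le> 3 ^ t * (2 ^ t * n)" using q(3) by (simp add: power_mult_distrib)
    finally have "2 ^ (t + 1) * (2 * q + 1) ^ t \<le> 2 ^ (t + 1) * (3 ^ t * (2 ^ t * n))"
      by (intro mult_left_mono) auto
    also have "\<dots> = 2 * 12 ^ t * n"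
      by (simp add: mult_ac flip: power_mult_distrib)
    finally have "2 ^ (2 * q) \<le> graph_diameter (hanoi_graph k (2 * 12 ^ t * n))"
      by (rule graph_diameter_hanoi_lower[OF t(1,2)])
    then have "(2::real) ^ (2 * q) \<le> real (graph_diameter (hanoi_graph k (2 * 12 ^ t * n)))"
      by (metis of_nat_le_iff of_nat_numeral of_nat_power)
    moreover have "exp (real n powr (1 / real t)) \<le> exp (real q)" using q(1) by simp
    moreover have "exp (real q) = exp 1 ^ q" by (simp add: exp_of_nat_mult[symmetric])
    moreover have "exp 1 ^ q \<le> (4::real) ^ q" using exp_le by (intro power_mono) auto
    moreover have "(4::real) ^ q = 2 ^ (2 * q)" by (simp add: power_mult)
    ultimately show ?thesis by linarith
  qed
  have "growth_le (\<lambda>n. real (graph_diameter (hanoi_graph k n))) (\<lambda>n. exp (real n powr (1 / real t)))"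
    unfolding growth_le_def using upper by (intro exI[of _ "(1 + 4 * t) ^ t"]) auto
  moreover have "growth_le (\<lambda>n. exp (real n powr (1 / real t))) (\<lambda>n. real (graph_diameter (hanoi_graph k n)))"
    unfolding growth_le_def using lower by (intro exI[of _ "2 * 12 ^ t"]) auto
  ultimately show ?thesis
    by (simp add: growth_eq_def t(3))
qed

end
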